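(* Let $q>1$. Then $$BV^q(\mathbb{R}^N,\mathbb{R}^d)=B^{1/q}_{q,\infty}(\mathbb{R}^N,\mathbb{R}^d).$$ Moreover, for every open $\Omega\subset\mathbb{R}^N$, $$BV^q_{loc}(\Omega,\mathbb{R}^d)=\big(B^{1/q}_{q,\infty}\big)_{loc}(\Omega,\mathbb{R}^d).$$
   Context: For $\Omega\subset\mathbb{R}^N$ open, $q\ge 1$ and $u\in L^q_{loc}(\Omega,\mathbb{R}^d)$ define $$\bar A_{u,q}(\Omega):=\sup_{\varepsilon\in(0,1)}\int_\Omega\int_{B_\varepsilon(x)\cap\Omega}\frac{1}{\varepsilon^N}\frac{|u(y)-u(x)|^q}{|y-x|}\,dy\,dx .$$ $BV^q(\Omega,\mathbb{R}^d)$ is the set of $u\in L^q(\Omega,\mathbb{R}^d)$ with $\bar A_{u,q}(\Omega)<\infty$. A function $u\in L^q_{loc}(\Omega,\mathbb{R}^d)$ belongs to $BV^q_{loc}(\Omega,\mathbb{R}^d)$ if $u\in BV^q(\Omega',\mathbb{R}^d)$ for every open $\Omega'\subset\subset\Omega$ (i.e. $\overline{\Omega'}$ is a compact subset of $\Omega$). For $q\ge1$ and $s\in(0,1)$, $u\in L^q(\mathbb{R}^N,\mathbb{R}^d)$ belongs to the Besov space $B^s_{q,\infty}(\mathbb{R}^N,\mathbb{R}^d)$ if $$\sup_{\rho\in(0,\infty)}\Big(\sup_{|h|\le\rho}\int_{\mathbb{R}^N}\frac{|u(x+h)-u(x)|^q}{\rho^{sq}}\,dx\Big)<\infty .$$ For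 $\Omega$ open, $u\in L^q_{loc}(\Omega,\mathbb{R}^d)$ belongs to $\big(B^s_{q,\infty}\big)_{loc}(\Omega,\mathbb{R}^d)$ if for every compact $K\subset\Omega$ there exists $u_K\in B^s_{q,\infty}(\mathbb{R}^N,\mathbb{R}^d)$ with $u_K(x)=u(x)$ for every $x\in K$ (functions being identified when equal a.e.). *)

theory Defs
  imports "HOL-Analysis.Analysis"
begin

text \<open>
  Elements of the function spaces are represented by total functions
  \<open>real ^ 'N \<Rightarrow> real ^ 'd\<close>. For a space over \<open>\<Omega>\<close> the values outside \<open>\<Omega>\<close> are irrelevant.
  No quotient by almost-everywhere equality is formed: every space below is closed under changing
  a function on a null set, so that an equality of the sets of representatives is the same as an
  equality of the sets of equivalence classes.
\<close>

definition Lq :: "real \<Rightarrow> (real ^ 'N) set \<Rightarrow> (real ^ 'N \<Rightarrow> real ^ 'd) set" where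
  "Lq q \<Omega> = {u. u \<in> borel_measurable (lebesgue_on \<Omega>) \<and>
                 integrable (lebesgue_on \<Omega>) (\<lambda>x. norm (u x) powr q)}"

definition Lq_loc :: "real \<Rightarrow> (real ^ 'N) set \<Rightarrow> (real ^ 'N \<Rightarrow> real ^ 'd) set" where
  "Lq_loc q \<Omega> = {u. u \<in> borel_measurable (lebesgue_on \<Omega>) \<and>
                     (\<forall>K. compact K \<and> K \<subseteq> \<Omega> \<longrightarrow> u \<in> Lq q K)}"

text \<open>
  The integrals are nonnegative Lebesgue integrals, with values in \<open>[0, \<infinity>]\<close>. On the
  diagonal \<open>y = x\<close>, a null set for the inner integral, the integrand is \<open>0 / 0 = 0\<close>.
\<close>

definition A_bar :: "real \<Rightarrow> (real ^ 'N) set \<Rightarrow> (real ^ 'N \<Rightarrow> real ^ 'd) \<Rightarrow> ennreal" where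
  "A_bar q \<Omega> u =
     (SUP \<epsilon>\<in>{0<..<1::real}.
        \<integral>\<^sup>+x\<in>\<Omega>. (\<integral>\<^sup>+y\<in>ball x \<epsilon> \<inter> \<Omega>.
            ennreal (1 / \<epsilon> ^ CARD('N) * (norm (u y - u x) powr q / norm (y - x)))
          \<partial>lebesgue) \<partial>lebesgue)"

definition BVq :: "real \<Rightarrow> (real ^ 'N) set \<Rightarrow> (real ^ 'N \<Rightarrow> real ^ 'd) set" where
  "BVq q \<Omega> = {u \<in> Lq q \<Omega>. A_bar q \<Omega> u < \<infinity>}"

definition BVq_loc :: "real \<Rightarrow> (real ^ 'N) set \<Rightarrow> (real ^ 'N \<Rightarrow> real ^ 'd) set" where
  "BVq_loc q \<Omega> = {u \<in> Lq_loc q \<Omega>.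
     \<forall>\<Omega>'. open \<Omega>' \<and> compact (closure \<Omega>') \<and> closure \<Omega>' \<subseteq> \<Omega> \<longrightarrow> u \<in> BVq q \<Omega>'}"

text \<open>The Besov space \<open>B\<^sup>s\<^sub>q\<^sub>,\<^sub>\<infinity>(\<real>\<^sup>N, \<real>\<^sup>d)\<close>, meant for \<open>q \<ge> 1\<close> and \<open>0 < s < 1\<close>.\<close>

definition Besov :: "real \<Rightarrow> real \<Rightarrow> (real ^ 'N \<Rightarrow> real ^ 'd) set" where
  "Besov s q = {u \<in> Lq q UNIV.
     (SUP \<rho>\<in>{0<..}. SUP h\<in>{h. norm h \<le> \<rho>}.
        \<integral>\<^sup>+x. ennreal (norm (u (x + h) - u x) powr q / \<rho> powr (s * q)) \<partial>lebesgue) < \<infinity>}"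

definition Besov_loc ::
  "real \<Rightarrow> real \<Rightarrow> (real ^ 'N) set \<Rightarrow> (real ^ 'N \<Rightarrow> real ^ 'd) set" where
  "Besov_loc s q \<Omega> = {u \<in> Lq_loc q \<Omega>.
     \<forall>K. compact K \<and> K \<subseteq> \<Omega> \<longrightarrow>
       (\<exists>u\<^sub>K \<in> Besov s q. AE x in lebesgue. x \<in> K \<longrightarrow> u\<^sub>K x = u x)}"

end

theory Submission
  imports Defs
begin

text \<open>
  Both spaces are described by the translation energy
  \<open>E h = \<integral> |u (x + h) - u x|\<^sup>q dx\<close>. The Besov condition with \<open>s = 1 / q\<close> says
  \<open>E h \<le> C |h|\<close> for all \<open>h\<close> (\<open>Besov_iff_translation_energy_le\<close>). Substituting \<open>y = x + h\<close> and
  exchanging the integrals turns the functional \<open>A_bar\<close> into the supremum over \<open>\<epsilon> < 1\<close> of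
  \<open>\<epsilon>\<^sup>-\<^sup>N \<integral> E h / |h| dh\<close> over the ball of radius \<open>\<epsilon>\<close> (\<open>A_bar_eq_average\<close>), that is, the same
  condition in the mean over balls. So the Besov condition bounds \<open>A_bar\<close> at once (\<open>A_bar_le\<close>).

  Conversely, a bound in the mean becomes a pointwise one because \<open>E\<close> is subadditive up to a
  factor: \<open>E h \<le> 2\<^sup>q (E (h + z) + E z)\<close> for every \<open>z\<close>. Averaging this over \<open>|z| < |h|\<close> bounds \<open>E h\<close>
  by the mean of \<open>E\<close> over the ball of radius \<open>2 |h|\<close>, hence by a multiple of \<open>|h|\<close>, as long as
  \<open>2 |h| < 1\<close> (\<open>translation_energy_le_A_bar\<close>). For larger \<open>h\<close> the energy is bounded by a multiple
  of the \<open>L\<^sup>q\<close> norm, which suffices since \<open>|h|\<close> is bounded below.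

  For the local statement, a function that agrees on the closure of \<open>\<Omega>'\<close> with one in the global
  space has finite \<open>A_bar\<close> on \<open>\<Omega>'\<close>, because \<open>A_bar\<close> grows with the domain. In the other
  direction, given a compact \<open>K\<close>, the function \<open>u\<close> is multiplied by a Lipschitz cutoff \<open>\<eta>\<close> that is 1
  on \<open>K\<close> and vanishes outside a neighbourhood \<open>U\<close> of \<open>K\<close>. The product rule for differences bounds
  the energy of \<open>\<eta> u\<close> by that of \<open>u\<close> on \<open>U\<close> plus a multiple of \<open>|h|\<^sup>q\<close>, and \<open>|h|\<^sup>q \<le> |h|\<close> for
  \<open>|h| < 1\<close> (\<open>cutoff_in_BVq\<close>).

  Representatives are only Lebesgue measurable, so that Fubini's theorem for \<open>lborel\<close> does not
  apply to them directly. All quantities are invariant under changes on null sets, and the estimates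
  are therefore proved for Borel functions.
\<close>

section \<open>Preliminaries on Lebesgue measure and Lq\<close>

lemma powr_add_le:
  fixes a b q :: real
  assumes "0 \<le> a" "0 \<le> b" "0 \<le> q"
  shows "(a + b) powr q \<le> 2 powr q * (a powr q + b powr q)"
proof -
  have "(a + b) powr q \<le> (2 * max a b) powr q"
    using assms by (intro powr_mono2) auto
  also have "\<dots> = 2 powr q * max a b powr q"
    using assms by (simp add: powr_mult)
  also have "max a b powr q \<le> a powr q + b powr q"
    by (simp add: max_def)
  finally show ?thesis
    by simp
qed

lemma nn_integral_lborel_translate:
  fixes f :: "'a :: euclidean_space \<Rightarrow> ennreal"
  assumes [measurable]: "f \<in> borel_measurable borel"
  shows "(\<integral>\<^sup>+x. f (c + x) \<partial>lborel) = (\<integral>\<^sup>+x. f x \<partial>lborel)"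
  by (subst lborel_distr_plus[of c, symmetric]) (simp add: nn_integral_distr)

lemma AE_lborel_translate:
  fixes c :: "'a :: euclidean_space"
  assumes "AE x in lborel. P x"
  shows "AE x in lborel. P (x + c)"
proof -
  have "AE x in distr lborel borel ((+) c). P x"
    using assms by (subst lborel_distr_plus)
  then show ?thesis
    by (subst add.commute) (rule AE_distrD[rotated], auto)
qed

text \<open>
  A Lebesgue measurable real function agrees almost everywhere with a Borel one; here this is applied
  to each of the finitely many coordinates.
\<close>

lemma borel_representative:
  fixes f :: "'a :: euclidean_space \<Rightarrow> 'b :: euclidean_space"
  assumes f: "f \<in> borel_measurable lebesgue"
  shows "\<exists>g\<in>borel_measurable borel. AE x in lborel. f x = g x"
proof -
  have "\<exists>g\<in>borel_measurable lborel. AE x in lborel. f x \<bullet> i = (g x :: real)" for i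
    using f by (intro completion_ex_borel_measurable_real) simp
  then obtain g :: "'b \<Rightarrow> 'a \<Rightarrow> real" where
    g [measurable]: "\<And>i. g i \<in> borel_measurable borel" and
    eq: "\<And>i. AE x in lborel. f x \<bullet> i = g i x"
    by simp metis
  have "AE x in lborel. \<forall>i\<in>Basis. f x \<bullet> i = g i x"
    using eq by (intro AE_ball_countable') (auto simp: countable_finite)
  then have "AE x in lborel. f x = (\<Sum>i\<in>Basis. g i x *\<^sub>R i)"
  proof eventually_elim
    case (elim x)
    have "f x = (\<Sum>i\<in>Basis. (f x \<bullet> i) *\<^sub>R i)"
      by (simp add: euclidean_representation)
    also have "\<dots> = (\<Sum>i\<in>Basis. g i x *\<^sub>R i)"
      using elim by (intro sum.cong) auto
    finally show ?case .
  qed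
  then show ?thesis
    by (intro bexI[of _ "\<lambda>x. \<Sum>i\<in>Basis. g i x *\<^sub>R i"]) auto
qed

text \<open>
  The replacement of a function by a Borel one that allows the use of Fubini's theorem. Extension by
  zero makes the norm on \<open>\<Omega>\<close> an integral over the whole space, which is translation invariant; the
  cutoff argument needs this.
\<close>

lemma Lq_representative:
  fixes u :: "real ^ 'N \<Rightarrow> real ^ 'd"
  assumes u: "u \<in> Lq q \<Omega>" and \<Omega> [measurable]: "\<Omega> \<in> sets borel"
  obtains v where "v \<in> borel_measurable borel" "AE x in lborel. x \<in> \<Omega> \<longrightarrow> v x = u x"
    "\<And>x. x \<notin> \<Omega> \<Longrightarrow> v x = 0" "(\<integral>\<^sup>+x. ennreal (norm (v x) powr q) \<partial>lborel) < \<infinity>"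
proof -
  have \<Omega>': "\<Omega> \<in> sets lebesgue"
    using \<Omega> by simp
  have "u \<in> borel_measurable (lebesgue_on \<Omega>)"
    using u by (simp add: Lq_def)
  then have "(\<lambda>x. if x \<in> \<Omega> then u x else 0) \<in> borel_measurable lebesgue"
    using \<Omega>' by (rule borel_measurable_if_I)
  from borel_representative[OF this] obtain g where g [measurable]: "g \<in> borel_measurable borel"
    and ae: "AE x in lborel. (if x \<in> \<Omega> then u x else 0) = g x"
    by auto
  define v where "v = (\<lambda>x. indicator \<Omega> x *\<^sub>R g x)"
  have v [measurable]: "v \<in> borel_measurable borel"
    unfolding v_def by measurable
  have eq: "AE x in lborel. x \<in> \<Omega> \<longrightarrow> v x = u x"
    using ae by eventually_elim (auto simp: v_def)
  have "(\<integral>\<^sup>+x. ennreal (norm (v x) powr q) \<partial>lborel)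
      = (\<integral>\<^sup>+x. ennreal (norm (u x) powr q) * indicator \<Omega> x \<partial>lborel)"
    using eq by (intro nn_integral_cong_AE, eventually_elim) (auto simp: v_def indicator_def)
  also have "\<dots> = (\<integral>\<^sup>+x. ennreal (norm (u x) powr q) * indicator \<Omega> x \<partial>lebesgue)"
    by (simp add: nn_integral_completion)
  also have "\<dots> = (\<integral>\<^sup>+x. ennreal (norm (u x) powr q) \<partial>lebesgue_on \<Omega>)"
    using \<Omega>' by (subst nn_integral_restrict_space) auto
  also have "\<dots> < \<infinity>"
    using u by (auto simp: Lq_def integrable_iff_bounded)
  finally show ?thesis
    by (intro that[of v] v eq) (auto simp: v_def)
qed

lemma borel_measurable_in_Lq:
  fixes v :: "real ^ 'N \<Rightarrow> real ^ 'd"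
  assumes [measurable]: "v \<in> borel_measurable borel"
    and "(\<integral>\<^sup>+x. ennreal (norm (v x) powr q) \<partial>lborel) < \<infinity>"
  shows "v \<in> Lq q UNIV"
proof -
  have "integrable lborel (\<lambda>x. norm (v x) powr q)"
    using assms(2) by (intro integrableI_bounded) auto
  then have "integrable lebesgue (\<lambda>x. norm (v x) powr q)"
    by (subst integrable_completion) auto
  moreover have "v \<in> borel_measurable lebesgue"
    by (intro measurable_completion) simp
  ultimately show ?thesis
    by (simp add: Lq_def lebesgue_on_UNIV_eq)
qed

lemma Lq_subset:
  fixes u :: "real ^ 'N \<Rightarrow> real ^ 'd"
  assumes u: "u \<in> Lq q T" and "S \<subseteq> T" "S \<in> sets lebesgue" "T \<in> sets lebesgue"
  shows "u \<in> Lq q S"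
proof -
  have "set_integrable lebesgue T (\<lambda>x. norm (u x) powr q)"
    using u assms by (simp add: Lq_def set_integrable_def integrable_restrict_space)
  then have "set_integrable lebesgue S (\<lambda>x. norm (u x) powr q)"
    by (rule set_integrable_subset) (use assms in auto)
  then show ?thesis
    using u assms
    by (auto simp: Lq_def set_integrable_def integrable_restrict_space
        intro: measurable_restrict_mono)
qed

section \<open>The translation energy\<close>

text \<open>
  The set of admissible \<open>x\<close> is the one produced from the double integral over \<open>\<Omega>\<close> by
  substituting \<open>y = x + h\<close>.
\<close>

definition translation_energy ::
  "real \<Rightarrow> (real ^ 'N) set \<Rightarrow> (real ^ 'N \<Rightarrow> real ^ 'd) \<Rightarrow> real ^ 'N \<Rightarrow> ennreal" where
  "translation_energy q \<Omega> u h =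
     (\<integral>\<^sup>+x\<in>{x \<in> \<Omega>. x + h \<in> \<Omega>}. ennreal (norm (u (x + h) - u x) powr q) \<partial>lborel)"

lemma translation_energy_zero [simp]: "translation_energy q \<Omega> u 0 = 0"
  by (simp add: translation_energy_def)

lemma borel_measurable_translation_energy [measurable]:
  fixes u :: "real ^ 'N \<Rightarrow> real ^ 'd"
  assumes [measurable]: "u \<in> borel_measurable borel" "\<Omega> \<in> sets borel"
  shows "translation_energy q \<Omega> u \<in> borel_measurable borel"
proof -
  have "(\<lambda>h. \<integral>\<^sup>+x. ennreal (norm (u (x + h) - u x) powr q) *
      (indicator \<Omega> x * indicator \<Omega> (x + h)) \<partial>lborel) \<in> borel_measurable borel"
    by measurable
  also have "(\<lambda>h. \<integral>\<^sup>+x. ennreal (norm (u (x + h) - u x) powr q) *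
      (indicator \<Omega> x * indicator \<Omega> (x + h)) \<partial>lborel) = translation_energy q \<Omega> u"
    by (auto simp: translation_energy_def fun_eq_iff indicator_def intro!: nn_integral_cong)
  finally show ?thesis .
qed

lemma translation_energy_AE_cong:
  assumes "AE x in lborel. x \<in> \<Omega> \<longrightarrow> v x = u x"
  shows "translation_energy q \<Omega> v h = translation_energy q \<Omega> u h"
  unfolding translation_energy_def
proof (rule nn_integral_cong_AE)
  show "AE x in lborel. ennreal (norm (v (x + h) - v x) powr q) * indicator {x \<in> \<Omega>. x + h \<in> \<Omega>} x
      = ennreal (norm (u (x + h) - u x) powr q) * indicator {x \<in> \<Omega>. x + h \<in> \<Omega>} x"
    using assms AE_lborel_translate[OF assms, of h]
    by eventually_elim (auto simp: indicator_def)
qed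

lemma A_bar_AE_cong:
  assumes "AE x in lborel. x \<in> \<Omega> \<longrightarrow> v x = u x"
  shows "A_bar q \<Omega> v = A_bar q \<Omega> u"
  unfolding A_bar_def nn_integral_completion
proof (rule SUP_cong[OF refl], rule nn_integral_cong_AE)
  fix \<epsilon> :: real
  let ?I = "\<lambda>u x. (\<integral>\<^sup>+y\<in>ball x \<epsilon> \<inter> \<Omega>.
    ennreal (1 / \<epsilon> ^ CARD('a) * (norm (u y - u x) powr q / norm (y - x))) \<partial>lborel)"
  show "AE x in lborel. ?I v x * indicator \<Omega> x = ?I u x * indicator \<Omega> x"
    using assms
  proof eventually_elim
    case (elim x)
    have "?I v x = ?I u x" if "x \<in> \<Omega>"
      using assms by (intro nn_integral_cong_AE, eventually_elim) (use elim that in \<open>auto simp: indicator_def\<close>)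
    then show ?case
      by (auto simp: indicator_def)
  qed
qed

lemma A_bar_mono:
  assumes "S \<subseteq> T"
  shows "A_bar q S u \<le> A_bar q T u"
  unfolding A_bar_def
  by (intro SUP_mono bexI nn_integral_mono mult_mono) (use assms in \<open>auto simp: indicator_def\<close>)

text \<open>
  Tonelli's theorem after the substitution \<open>y = x + h\<close>: the factor \<open>1 / |y - x|\<close> and the
  condition \<open>|y - x| < \<epsilon>\<close> depend on \<open>h\<close> alone.
\<close>

lemma A_bar_eq_average:
  fixes u :: "real ^ 'N \<Rightarrow> real ^ 'd"
  assumes [measurable]: "u \<in> borel_measurable borel" "\<Omega> \<in> sets borel"
  shows "A_bar q \<Omega> u = (SUP \<epsilon>\<in>{0<..<1}. \<integral>\<^sup>+h\<in>ball 0 \<epsilon>.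
    ennreal (1 / \<epsilon> ^ CARD('N) / norm h) * translation_energy q \<Omega> u h \<partial>lborel)"
  unfolding A_bar_def nn_integral_completion
proof (rule SUP_cong[OF refl])
  fix \<epsilon> :: real assume \<epsilon>: "\<epsilon> \<in> {0<..<1}"
  define G where "G x y = ennreal (1 / \<epsilon> ^ CARD('N) * (norm (u y - u x) powr q / norm (y - x)))
    * indicator {h. norm h < \<epsilon>} (y - x) * indicator \<Omega> y * indicator \<Omega> x" for x y
  have [measurable]: "(\<lambda>(x, y). G x y) \<in> borel_measurable (borel \<Otimes>\<^sub>M borel)"
    unfolding G_def by measurable
  have "(\<integral>\<^sup>+x\<in>\<Omega>. (\<integral>\<^sup>+y\<in>ball x \<epsilon> \<inter> \<Omega>. ennreal (1 / \<epsilon> ^ CARD('N) *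
      (norm (u y - u x) powr q / norm (y - x))) \<partial>lborel) \<partial>lborel)
    = (\<integral>\<^sup>+x. \<integral>\<^sup>+y. G x y \<partial>lborel \<partial>lborel)"
  proof (rule nn_integral_cong)
    fix x
    show "(\<integral>\<^sup>+y\<in>ball x \<epsilon> \<inter> \<Omega>. ennreal (1 / \<epsilon> ^ CARD('N) *
      (norm (u y - u x) powr q / norm (y - x))) \<partial>lborel) * indicator \<Omega> x
      = (\<integral>\<^sup>+y. G x y \<partial>lborel)"
    proof (cases "x \<in> \<Omega>")
      case True
      then show ?thesis
        by (auto simp: G_def indicator_def dist_norm norm_minus_commute intro!: nn_integral_cong)
    qed (simp add: G_def)
  qed
  also have "\<dots> = (\<integral>\<^sup>+x. \<integral>\<^sup>+h. G x (x + h) \<partial>lborel \<partial>lborel)"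
    by (intro nn_integral_cong nn_integral_lborel_translate[symmetric]) measurable
  also have "\<dots> = (\<integral>\<^sup>+h. \<integral>\<^sup>+x. G x (x + h) \<partial>lborel \<partial>lborel)"
    by (intro lborel_pair.Fubini') measurable
  also have "\<dots> = (\<integral>\<^sup>+h\<in>ball 0 \<epsilon>. ennreal (1 / \<epsilon> ^ CARD('N) / norm h) *
      translation_energy q \<Omega> u h \<partial>lborel)"
  proof (rule nn_integral_cong)
    fix h
    have "(\<integral>\<^sup>+x. G x (x + h) \<partial>lborel) = (\<integral>\<^sup>+x. (ennreal (1 / \<epsilon> ^ CARD('N) / norm h) * indicator (ball 0 \<epsilon>) h) *
        (ennreal (norm (u (x + h) - u x) powr q) * indicator {x \<in> \<Omega>. x + h \<in> \<Omega>} x) \<partial>lborel)"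
      using \<epsilon> by (intro nn_integral_cong) (auto simp: G_def indicator_def ennreal_mult'[symmetric])
    also have "\<dots> = ennreal (1 / \<epsilon> ^ CARD('N) / norm h) * translation_energy q \<Omega> u h * indicator (ball 0 \<epsilon>) h"
      unfolding translation_energy_def by (subst nn_integral_cmult) (auto simp: mult_ac)
    finally show "(\<integral>\<^sup>+x. G x (x + h) \<partial>lborel) =
      ennreal (1 / \<epsilon> ^ CARD('N) / norm h) * translation_energy q \<Omega> u h * indicator (ball 0 \<epsilon>) h" .
  qed
  finally show "(\<integral>\<^sup>+x\<in>\<Omega>. (\<integral>\<^sup>+y\<in>ball x \<epsilon> \<inter> \<Omega>. ennreal (1 / \<epsilon> ^ CARD('N) *
      (norm (u y - u x) powr q / norm (y - x))) \<partial>lborel) \<partial>lborel)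
    = (\<integral>\<^sup>+h\<in>ball 0 \<epsilon>. ennreal (1 / \<epsilon> ^ CARD('N) / norm h) *
      translation_energy q \<Omega> u h \<partial>lborel)" .
qed


text \<open>
  The weight \<open>\<epsilon>\<^sup>-\<^sup>N / |h|\<close> turns a term linear in \<open>|h|\<close> into the constant \<open>\<epsilon>\<^sup>-\<^sup>N\<close>, whose integral
  over the ball of radius \<open>\<epsilon>\<close> is the volume of the unit ball for every \<open>\<epsilon>\<close>. The case \<open>D = 0\<close>
  shows that the Besov condition bounds \<open>A_bar\<close>; the energy term on the right is used for cutoffs.
\<close>

lemma A_bar_le:
  fixes u v :: "real ^ 'N \<Rightarrow> real ^ 'd"
  assumes [measurable]: "u \<in> borel_measurable borel" "S \<in> sets borel"
    "v \<in> borel_measurable borel" "T \<in> sets borel"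
    and bound: "\<And>h. norm h < 1 \<Longrightarrow>
      translation_energy q S u h \<le> D * translation_energy q T v h + C * ennreal (norm h)"
  shows "A_bar q S u \<le> D * A_bar q T v + C * ennreal (unit_ball_vol CARD('N))"
  unfolding A_bar_eq_average[OF assms(1,2)]
proof (rule SUP_least)
  fix \<epsilon> :: real assume \<epsilon>: "\<epsilon> \<in> {0<..<1}"
  define w where "w h = ennreal (1 / \<epsilon> ^ CARD('N) / norm h)" for h :: "real ^ 'N"
  have [measurable]: "w \<in> borel_measurable borel"
    unfolding w_def by measurable
  have [measurable]: "ball (0 :: real ^ 'N) \<epsilon> \<in> sets borel"
    by simp
  have "(\<integral>\<^sup>+h\<in>ball 0 \<epsilon>. w h * translation_energy q S u h \<partial>lborel)
      \<le> (\<integral>\<^sup>+h. D * (w h * translation_energy q T v h * indicator (ball 0 \<epsilon>) h) +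
            C * ennreal (1 / \<epsilon> ^ CARD('N)) * indicator (ball 0 \<epsilon>) h \<partial>lborel)"
  proof (rule nn_integral_mono)
    fix h :: "real ^ 'N"
    show "w h * translation_energy q S u h * indicator (ball 0 \<epsilon>) h
      \<le> D * (w h * translation_energy q T v h * indicator (ball 0 \<epsilon>) h) +
            C * ennreal (1 / \<epsilon> ^ CARD('N)) * indicator (ball 0 \<epsilon>) h"
    proof (cases "norm h < \<epsilon>")
      case True
      have "w h * ennreal (norm h) \<le> ennreal (1 / \<epsilon> ^ CARD('N))"
        using \<epsilon> by (auto simp: w_def ennreal_mult'[symmetric] intro!: ennreal_leI)
      moreover have "w h * translation_energy q S u h
          \<le> w h * (D * translation_energy q T v h + C * ennreal (norm h))"
        using True \<epsilon> by (intro mult_left_mono bound) auto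
      then have "w h * translation_energy q S u h
          \<le> D * (w h * translation_energy q T v h) + C * (w h * ennreal (norm h))"
        by (simp add: algebra_simps)
      ultimately have "w h * translation_energy q S u h
          \<le> D * (w h * translation_energy q T v h) + C * ennreal (1 / \<epsilon> ^ CARD('N))"
        by (meson add_left_mono mult_left_mono order_trans zero_le)
      then show ?thesis
        using True by simp
    qed simp
  qed
  also have "\<dots> = D * (\<integral>\<^sup>+h\<in>ball 0 \<epsilon>. w h * translation_energy q T v h \<partial>lborel) +
      C * (ennreal (1 / \<epsilon> ^ CARD('N)) * emeasure lborel (ball (0 :: real ^ 'N) \<epsilon>))"
    by (subst nn_integral_add) (auto simp: nn_integral_cmult mult.assoc)
  also have "ennreal (1 / \<epsilon> ^ CARD('N)) * emeasure lborel (ball (0 :: real ^ 'N) \<epsilon>)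
      = ennreal (unit_ball_vol CARD('N))"
    using \<epsilon> by (simp add: emeasure_ball ennreal_mult'[symmetric])
  also have "(\<integral>\<^sup>+h\<in>ball 0 \<epsilon>. w h * translation_energy q T v h \<partial>lborel) \<le> A_bar q T v"
    unfolding A_bar_eq_average[OF assms(3,4)] w_def using \<epsilon> by (rule SUP_upper)
  finally show "(\<integral>\<^sup>+h\<in>ball 0 \<epsilon>. ennreal (1 / \<epsilon> ^ CARD('N) / norm h) * translation_energy q S u h \<partial>lborel)
    \<le> D * A_bar q T v + C * ennreal (unit_ball_vol CARD('N))"
    unfolding w_def by (simp add: add_right_mono mult_left_mono)
qed

section \<open>From averages to pointwise bounds\<close>

text \<open>
  On the ball of radius \<open>r\<close> the weight \<open>r\<^sup>-\<^sup>N / |h|\<close> is at least \<open>r\<^sup>-\<^sup>(\<^sup>N\<^sup>+\<^sup>1\<^sup>)\<close>.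
\<close>

lemma nn_integral_translation_energy_ball_le:
  fixes u :: "real ^ 'N \<Rightarrow> real ^ 'd"
  assumes [measurable]: "u \<in> borel_measurable borel" "\<Omega> \<in> sets borel"
    and r: "0 < r" "r < 1"
  shows "(\<integral>\<^sup>+h\<in>ball 0 r. translation_energy q \<Omega> u h \<partial>lborel)
    \<le> ennreal (r ^ (CARD('N) + 1)) * A_bar q \<Omega> u"
proof -
  have [measurable]: "ball (0 :: real ^ 'N) r \<in> sets borel"
    by simp
  have "(\<integral>\<^sup>+h\<in>ball 0 r. translation_energy q \<Omega> u h \<partial>lborel)
      \<le> (\<integral>\<^sup>+h. ennreal (r ^ (CARD('N) + 1)) * (ennreal (1 / r ^ CARD('N) / norm h) *
            translation_energy q \<Omega> u h * indicator (ball 0 r) h) \<partial>lborel)"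
  proof (rule nn_integral_mono)
    fix h :: "real ^ 'N"
    show "translation_energy q \<Omega> u h * indicator (ball 0 r) h \<le> ennreal (r ^ (CARD('N) + 1)) *
      (ennreal (1 / r ^ CARD('N) / norm h) * translation_energy q \<Omega> u h * indicator (ball 0 r) h)"
      \<comment> \<open>At \<open>h = 0\<close> the weight is 0 by the convention for division, but so is the energy.\<close>
    proof (cases "norm h < r \<and> h \<noteq> 0")
      case True
      have "1 \<le> ennreal (r ^ (CARD('N) + 1)) * ennreal (1 / r ^ CARD('N) / norm h)"
        using True r by (auto simp: ennreal_mult'[symmetric])
      then have "1 * translation_energy q \<Omega> u h \<le> ennreal (r ^ (CARD('N) + 1)) *
          ennreal (1 / r ^ CARD('N) / norm h) * translation_energy q \<Omega> u h"
        by (intro mult_right_mono) auto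
      then show ?thesis
        using True by (simp add: mult_ac)
    qed auto
  qed
  also have "\<dots> = ennreal (r ^ (CARD('N) + 1)) * (\<integral>\<^sup>+h\<in>ball 0 r.
      ennreal (1 / r ^ CARD('N) / norm h) * translation_energy q \<Omega> u h \<partial>lborel)"
    by (rule nn_integral_cmult) measurable
  also have "\<dots> \<le> ennreal (r ^ (CARD('N) + 1)) * A_bar q \<Omega> u"
    unfolding A_bar_eq_average[OF assms(1,2)] using r by (intro mult_left_mono SUP_upper) auto
  finally show ?thesis .
qed

lemma ennreal_norm_diff_powr_le:
  fixes a b c :: "'a :: real_normed_vector"
  assumes "0 \<le> q"
  shows "ennreal (norm (a - b) powr q)
    \<le> ennreal (2 powr q) * (ennreal (norm (a - c) powr q) + ennreal (norm (c - b) powr q))"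
proof -
  have "norm (a - b) powr q \<le> (norm (a - c) + norm (c - b)) powr q"
    using assms norm_triangle_ineq[of "a - c" "c - b"] by (intro powr_mono2) auto
  also have "\<dots> \<le> 2 powr q * (norm (a - c) powr q + norm (c - b) powr q)"
    using assms by (intro powr_add_le) auto
  finally show ?thesis
    by (simp add: ennreal_mult'[symmetric] ennreal_leI flip: ennreal_plus)
qed

text \<open>
  Going from \<open>x\<close> to \<open>x + h\<close> by way of \<open>x + h + z\<close> costs two translations, by \<open>h + z\<close> and by \<open>z\<close>.
  With \<open>x + z\<close> as the intermediate point the first translation would be by \<open>h - z\<close>, and averaging over
  \<open>z\<close> would need a reflection in addition to the translation invariance of Lebesgue measure.
\<close>

lemma translation_energy_quasi_subadditive:
  fixes u :: "real ^ 'N \<Rightarrow> real ^ 'd"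
  assumes [measurable]: "u \<in> borel_measurable borel" and "0 \<le> q"
  shows "translation_energy q UNIV u h
    \<le> ennreal (2 powr q) * (translation_energy q UNIV u (h + z) + translation_energy q UNIV u z)"
proof -
  have "translation_energy q UNIV u h \<le> (\<integral>\<^sup>+x. ennreal (2 powr q) *
      (ennreal (norm (u (x + (h + z)) - u x) powr q) +
       ennreal (norm (u ((h + x) + z) - u (h + x)) powr q)) \<partial>lborel)"
    unfolding translation_energy_def
  proof (intro nn_integral_mono)
    fix x
    show "ennreal (norm (u (x + h) - u x) powr q) * indicator {x \<in> UNIV. x + h \<in> UNIV} x
      \<le> ennreal (2 powr q) * (ennreal (norm (u (x + (h + z)) - u x) powr q) +
       ennreal (norm (u ((h + x) + z) - u (h + x)) powr q))"
      using ennreal_norm_diff_powr_le[OF \<open>0 \<le> q\<close>, of "u (x + h)" "u x" "u (x + (h + z))"]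
      by (simp add: add_ac norm_minus_commute)
  qed
  also have "\<dots> = ennreal (2 powr q) *
      ((\<integral>\<^sup>+x. ennreal (norm (u (x + (h + z)) - u x) powr q) \<partial>lborel) +
       (\<integral>\<^sup>+x. ennreal (norm (u ((h + x) + z) - u (h + x)) powr q) \<partial>lborel))"
    by (subst nn_integral_cmult) (auto simp: nn_integral_add)
  also have "(\<integral>\<^sup>+x. ennreal (norm (u ((h + x) + z) - u (h + x)) powr q) \<partial>lborel)
      = (\<integral>\<^sup>+x. ennreal (norm (u (x + z) - u x) powr q) \<partial>lborel)"
    by (rule nn_integral_lborel_translate) measurable
  finally show ?thesis
    by (simp add: translation_energy_def)
qed

lemma translation_energy_le_Lq:
  fixes u :: "real ^ 'N \<Rightarrow> real ^ 'd"
  assumes [measurable]: "u \<in> borel_measurable borel" and "0 \<le> q"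
  shows "translation_energy q UNIV u h
    \<le> ennreal (2 * 2 powr q) * (\<integral>\<^sup>+x. ennreal (norm (u x) powr q) \<partial>lborel)"
proof -
  have "translation_energy q UNIV u h \<le> (\<integral>\<^sup>+x. ennreal (2 powr q) *
      (ennreal (norm (u (h + x)) powr q) + ennreal (norm (u x) powr q)) \<partial>lborel)"
    unfolding translation_energy_def
  proof (intro nn_integral_mono)
    fix x
    show "ennreal (norm (u (x + h) - u x) powr q) * indicator {x \<in> UNIV. x + h \<in> UNIV} x
      \<le> ennreal (2 powr q) * (ennreal (norm (u (h + x)) powr q) + ennreal (norm (u x) powr q))"
      using ennreal_norm_diff_powr_le[OF \<open>0 \<le> q\<close>, of "u (x + h)" "u x" 0]
      by (simp add: add_ac)
  qed
  also have "\<dots> = ennreal (2 powr q) * ((\<integral>\<^sup>+x. ennreal (norm (u (h + x)) powr q) \<partial>lborel) +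
      (\<integral>\<^sup>+x. ennreal (norm (u x) powr q) \<partial>lborel))"
    by (subst nn_integral_cmult) (auto simp: nn_integral_add)
  also have "(\<integral>\<^sup>+x. ennreal (norm (u (h + x)) powr q) \<partial>lborel)
      = (\<integral>\<^sup>+x. ennreal (norm (u x) powr q) \<partial>lborel)"
    by (rule nn_integral_lborel_translate) measurable
  finally show ?thesis
    by (simp add: ennreal_mult' mult_ac flip: mult_2)
qed


text \<open>
  The inequality \<open>E h \<le> 2\<^sup>q (E (h + z) + E z)\<close> is integrated over \<open>|z| < |h| = r\<close>. Since \<open>z\<close> and
  \<open>h + z\<close> both stay in the ball of radius \<open>2 r\<close>, the right hand side becomes at most \<open>2 \<cdot> 2\<^sup>q\<close> times
  the integral of \<open>E\<close> over that ball, which is at most \<open>(2 r)\<^sup>N\<^sup>+\<^sup>1\<close> times \<open>A_bar\<close>; the left hand side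
  becomes \<open>E h\<close> times the volume of the ball of radius \<open>r\<close>. The quotient is linear in \<open>r\<close>. The
  bound on \<open>|h|\<close> keeps \<open>2 r\<close> in the range of the radii \<open>\<epsilon>\<close>.
\<close>

lemma translation_energy_le_A_bar:
  fixes u :: "real ^ 'N \<Rightarrow> real ^ 'd"
  assumes [measurable]: "u \<in> borel_measurable borel" and "0 \<le> q" and h: "norm h < 1 / 2"
  shows "translation_energy q UNIV u h
    \<le> ennreal (2 powr q * 2 ^ (CARD('N) + 2) / unit_ball_vol CARD('N)) * A_bar q UNIV u * ennreal (norm h)"
proof (cases "h = 0")
  case False
  define r where "r = norm h"
  define V where "V = unit_ball_vol CARD('N)"
  define E where "E = translation_energy q UNIV u"
  have r: "0 < r" "2 * r < 1"
    using False h by (auto simp: r_def)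
  have V: "0 < V"
    by (simp add: V_def)
  have [measurable]: "E \<in> borel_measurable borel"
    unfolding E_def by measurable
  have [measurable]: "ball (0 :: real ^ 'N) s \<in> sets borel" for s
    by simp
  have "ennreal (V * r ^ CARD('N)) * E h = (\<integral>\<^sup>+z\<in>ball (0 :: real ^ 'N) r. E h \<partial>lborel)"
    using r by (simp add: nn_integral_cmult_indicator emeasure_ball V_def mult.commute)
  also have "\<dots> \<le> (\<integral>\<^sup>+z. ennreal (2 powr q) *
      (E (h + z) * indicator (ball 0 (2 * r)) (h + z) + E z * indicator (ball 0 (2 * r)) z) \<partial>lborel)"
  proof (rule nn_integral_mono)
    fix z :: "real ^ 'N"
    show "E h * indicator (ball 0 r) z \<le> ennreal (2 powr q) *
      (E (h + z) * indicator (ball 0 (2 * r)) (h + z) + E z * indicator (ball 0 (2 * r)) z)"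
    proof (cases "norm z < r")
      case True
      then have "norm (h + z) < 2 * r" "norm z < 2 * r"
        using norm_triangle_ineq[of h z] r by (simp_all only: r_def)
      then show ?thesis
        using True translation_energy_quasi_subadditive[OF assms(1,2), of h z]
        by (simp add: E_def)
    qed simp
  qed
  also have "\<dots> = ennreal (2 powr q) *
      ((\<integral>\<^sup>+z. E (h + z) * indicator (ball 0 (2 * r)) (h + z) \<partial>lborel) +
       (\<integral>\<^sup>+z\<in>ball 0 (2 * r). E z \<partial>lborel))"
    by (subst nn_integral_cmult) (auto simp: nn_integral_add)
  also have "(\<integral>\<^sup>+z. E (h + z) * indicator (ball 0 (2 * r)) (h + z) \<partial>lborel)
      = (\<integral>\<^sup>+z\<in>ball 0 (2 * r). E z \<partial>lborel)"
    by (rule nn_integral_lborel_translate) measurable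
  also have "ennreal (2 powr q) * (\<dots> + \<dots>) = ennreal (2 powr q * 2) * \<dots>"
    by (simp add: ennreal_mult' mult_ac flip: mult_2)
  also have "\<dots> \<le> ennreal (2 powr q * 2) * (ennreal ((2 * r) ^ (CARD('N) + 1)) * A_bar q UNIV u)"
    unfolding E_def using r by (intro mult_left_mono nn_integral_translation_energy_ball_le) auto
  finally have le: "ennreal (V * r ^ CARD('N)) * E h
    \<le> ennreal (2 powr q * 2) * (ennreal ((2 * r) ^ (CARD('N) + 1)) * A_bar q UNIV u)" .
  have "E h = ennreal (1 / (V * r ^ CARD('N))) * (ennreal (V * r ^ CARD('N)) * E h)"
    using r V by (simp add: mult.assoc[symmetric] ennreal_mult'[symmetric])
  also have "\<dots> \<le> ennreal (1 / (V * r ^ CARD('N))) *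
      (ennreal (2 powr q * 2) * (ennreal ((2 * r) ^ (CARD('N) + 1)) * A_bar q UNIV u))"
    by (rule mult_left_mono[OF le]) simp
  also have "\<dots> = ennreal (1 / (V * r ^ CARD('N)) * (2 powr q * 2) * (2 * r) ^ (CARD('N) + 1)) * A_bar q UNIV u"
  proof -
    have "0 \<le> 1 / (V * r ^ CARD('N))" "0 \<le> 2 powr q * 2" "0 \<le> (2 * r) ^ (CARD('N) + 1)"
      using r V by auto
    then show ?thesis
      by (simp only: ennreal_mult mult_nonneg_nonneg mult.assoc)
  qed
  also have "1 / (V * r ^ CARD('N)) * (2 powr q * 2) * (2 * r) ^ (CARD('N) + 1)
      = (2 powr q * 2 ^ (CARD('N) + 2) / V) * r"
    using r V by (simp add: field_simps power_mult_distrib)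
  also have "ennreal (2 powr q * 2 ^ (CARD('N) + 2) / V * r) * A_bar q UNIV u
      = ennreal (2 powr q * 2 ^ (CARD('N) + 2) / V) * A_bar q UNIV u * ennreal r"
    using r by (subst ennreal_mult'') (simp_all only: mult_ac less_imp_le)
  finally show ?thesis
    by (simp only: E_def V_def r_def)
qed simp

section \<open>Equality of the global spaces\<close>

text \<open>
  For \<open>s = 1 / q\<close> the denominator \<open>\<rho> powr (s * q)\<close> is \<open>\<rho>\<close>, and for given \<open>h\<close> the smallest
  admissible \<open>\<rho>\<close>, namely \<open>|h|\<close>, gives the strongest condition.
\<close>

lemma Besov_iff_translation_energy_le:
  fixes u :: "real ^ 'N \<Rightarrow> real ^ 'd"
  assumes q: "0 < q"
  shows "u \<in> Besov (1 / q) q \<longleftrightarrow> u \<in> Lq q UNIV \<and>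
    (\<exists>C<\<infinity>. \<forall>h. translation_energy q UNIV u h \<le> C * ennreal (norm h))"
proof (cases "u \<in> Lq q UNIV")
  case True
  define E where "E = translation_energy q UNIV u"
  define S where "S = (SUP \<rho>\<in>{0<..}. SUP h\<in>{h. norm h \<le> \<rho>}. ennreal (1 / \<rho>) * E h)"
  obtain v where [measurable]: "v \<in> borel_measurable borel"
    and "AE x in lborel. x \<in> UNIV \<longrightarrow> v x = u x"
    using Lq_representative[OF True] by auto
  then have v: "AE x in lborel. v x = u x"
    by simp
  have "(\<integral>\<^sup>+x. ennreal (norm (u (x + h) - u x) powr q / \<rho> powr (1 / q * q)) \<partial>lebesgue)
      = ennreal (1 / \<rho>) * E h" if "0 < \<rho>" for h \<rho>
  proof -
    have "(\<integral>\<^sup>+x. ennreal (norm (u (x + h) - u x) powr q / \<rho> powr (1 / q * q)) \<partial>lebesgue)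
        = (\<integral>\<^sup>+x. ennreal (1 / \<rho>) * ennreal (norm (v (x + h) - v x) powr q) \<partial>lborel)"
      unfolding nn_integral_completion
      using v AE_lborel_translate[OF v, of h]
      by (intro nn_integral_cong_AE, eventually_elim)
        (use that q in \<open>auto simp: ennreal_mult'[symmetric]\<close>)
    also have "\<dots> = ennreal (1 / \<rho>) * translation_energy q UNIV v h"
      by (subst nn_integral_cmult) (auto simp: translation_energy_def)
    also have "translation_energy q UNIV v h = E h"
      unfolding E_def using v by (intro translation_energy_AE_cong) simp
    finally show ?thesis .
  qed
  then have "(SUP \<rho>\<in>{0<..}. SUP h\<in>{h. norm h \<le> \<rho>}.
      \<integral>\<^sup>+x. ennreal (norm (u (x + h) - u x) powr q / \<rho> powr (1 / q * q)) \<partial>lebesgue) = S"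
    unfolding S_def by (intro SUP_cong refl) auto
  then have "u \<in> Besov (1 / q) q \<longleftrightarrow> S < \<infinity>"
    using True by (simp add: Besov_def)
  also have "\<dots> \<longleftrightarrow> (\<exists>C<\<infinity>. \<forall>h. E h \<le> C * ennreal (norm h))"
  proof safe
    assume "S < \<infinity>"
    have "E h \<le> S * ennreal (norm h)" for h
    proof (cases "h = 0")
      case False
      have "ennreal (1 / norm h) * E h \<le> S"
        unfolding S_def using False by (intro SUP_upper2[of "norm h"] SUP_upper2[of h]) auto
      then have "ennreal (1 / norm h) * E h * ennreal (norm h) \<le> S * ennreal (norm h)"
        by (rule mult_right_mono) simp
      also have "ennreal (1 / norm h) * E h * ennreal (norm h)
          = ennreal (1 / norm h * norm h) * E h"
        by (subst ennreal_mult) (auto simp: mult_ac)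
      finally show ?thesis
        using False by simp
    qed (simp add: E_def)
    with \<open>S < \<infinity>\<close> show "\<exists>C<\<infinity>. \<forall>h. E h \<le> C * ennreal (norm h)"
      by blast
  next
    fix C :: ennreal assume C: "C < \<infinity>" "\<forall>h. E h \<le> C * ennreal (norm h)"
    have "S \<le> C"
      unfolding S_def
    proof (intro SUP_least)
      fix \<rho> :: real and h :: "real ^ 'N" assume \<rho>: "\<rho> \<in> {0<..}" and h: "h \<in> {h. norm h \<le> \<rho>}"
      have "ennreal (1 / \<rho>) * E h \<le> ennreal (1 / \<rho>) * (C * ennreal (norm h))"
        using C by (intro mult_left_mono) auto
      also have "\<dots> = C * ennreal (norm h / \<rho>)"
        using \<rho> by (simp add: mult_ac ennreal_mult'[symmetric])
      also have "\<dots> \<le> C * 1"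
        using \<rho> h by (intro mult_left_mono) (auto simp: ennreal_le_1)
      finally show "ennreal (1 / \<rho>) * E h \<le> C"
        by simp
    qed
    with C show "S < \<infinity>"
      by simp
  qed
  finally show ?thesis
    using True by (simp add: E_def)
qed (simp add: Besov_def)

lemma A_bar_finite_iff_translation_energy_le:
  fixes u :: "real ^ 'N \<Rightarrow> real ^ 'd"
  assumes q: "0 \<le> q" and u: "u \<in> Lq q UNIV"
  shows "A_bar q UNIV u < \<infinity> \<longleftrightarrow>
    (\<exists>C<\<infinity>. \<forall>h. translation_energy q UNIV u h \<le> C * ennreal (norm h))"
proof -
  obtain v where [measurable]: "v \<in> borel_measurable borel"
    and ae: "AE x in lborel. x \<in> UNIV \<longrightarrow> v x = u x"
    and Lq: "(\<integral>\<^sup>+x. ennreal (norm (v x) powr q) \<partial>lborel) < \<infinity>"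
    using Lq_representative[OF u] by auto
  define E where "E = translation_energy q UNIV v"
  define M where "M = (\<integral>\<^sup>+x. ennreal (norm (v x) powr q) \<partial>lborel)"
  have "A_bar q UNIV v < \<infinity> \<longleftrightarrow> (\<exists>C<\<infinity>. \<forall>h. E h \<le> C * ennreal (norm h))"
  proof safe
    assume A: "A_bar q UNIV v < \<infinity>"
    \<comment> \<open>The summands handle \<open>|h| < 1 / 2\<close> and \<open>|h| \<ge> 1 / 2\<close>; the final factor 2 is from \<open>1 \<le> 2 |h|\<close>.\<close>
    define C where "C = ennreal (2 powr q * 2 ^ (CARD('N) + 2) / unit_ball_vol CARD('N)) * A_bar q UNIV v
      + ennreal (2 * 2 powr q) * M * ennreal 2"
    have "C < \<infinity>"
      using A Lq by (auto simp: C_def M_def ennreal_mult_less_top)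
    moreover have "E h \<le> C * ennreal (norm h)" for h
    proof (cases "norm h < 1 / 2")
      case True
      then have "E h \<le> ennreal (2 powr q * 2 ^ (CARD('N) + 2) / unit_ball_vol CARD('N)) * A_bar q UNIV v *
          ennreal (norm h)"
        unfolding E_def using q by (intro translation_energy_le_A_bar) auto
      also have "\<dots> \<le> C * ennreal (norm h)"
        unfolding C_def by (intro mult_right_mono) auto
      finally show ?thesis .
    next
      case False
      have "E h \<le> ennreal (2 * 2 powr q) * M"
        unfolding E_def M_def using q by (intro translation_energy_le_Lq) auto
      also have "\<dots> \<le> ennreal (2 * 2 powr q) * M * ennreal (2 * norm h)"
        using False mult_left_mono[of 1 "ennreal (2 * norm h)" "ennreal (2 * 2 powr q) * M"] by simp
      also have "\<dots> = ennreal (2 * 2 powr q) * M * ennreal 2 * ennreal (norm h)"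
        by (simp only: mult.assoc ennreal_mult' norm_ge_zero)
      also have "\<dots> \<le> C * ennreal (norm h)"
        unfolding C_def by (intro mult_right_mono) auto
      finally show ?thesis .
    qed
    ultimately show "\<exists>C<\<infinity>. \<forall>h. E h \<le> C * ennreal (norm h)"
      by blast
  next
    fix C :: ennreal assume C: "C < \<infinity>" "\<forall>h. E h \<le> C * ennreal (norm h)"
    have "A_bar q UNIV v \<le> 0 * A_bar q UNIV v + C * ennreal (unit_ball_vol CARD('N))"
      by (rule A_bar_le) (use C in \<open>auto simp: E_def\<close>)
    also have "\<dots> < \<infinity>"
      using C by (auto simp: ennreal_mult_less_top)
    finally show "A_bar q UNIV v < \<infinity>" .
  qed
  then show ?thesis
    unfolding E_def translation_energy_AE_cong[OF ae] A_bar_AE_cong[OF ae] .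
qed

lemma BVq_UNIV_eq_Besov:
  assumes "0 < q"
  shows "(BVq q UNIV :: (real ^ 'N \<Rightarrow> real ^ 'd) set) = Besov (1 / q) q"
proof (rule set_eqI)
  fix u :: "real ^ 'N \<Rightarrow> real ^ 'd"
  show "u \<in> BVq q UNIV \<longleftrightarrow> u \<in> Besov (1 / q) q"
    using A_bar_finite_iff_translation_energy_le[of q u] assms
    unfolding BVq_def Besov_iff_translation_energy_le[OF assms] by auto
qed

section \<open>Cutoffs and the local spaces\<close>

text \<open>
  If \<open>x\<close> and \<open>y = x + h\<close> lie in \<open>\<Omega>\<close>, then
  \<open>\<eta> y v y - \<eta> x v x = \<eta> y (v y - v x) + (\<eta> y - \<eta> x) v x\<close>, where the first term is controlled by the energy
  of \<open>v\<close> on \<open>\<Omega>\<close> and the second by the Lipschitz bound. If only one of them lies in \<open>\<Omega>\<close>, then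
  \<open>\<eta>\<close> vanishes at the other, so the difference is still \<open>\<eta> y - \<eta> x\<close> times a value of
  \<open>v\<close>. This is why the energy of \<open>v\<close> enters only with both points in \<open>\<Omega>\<close>.
\<close>

lemma translation_energy_cutoff_le:
  fixes v :: "real ^ 'N \<Rightarrow> real ^ 'd" and \<eta> :: "real ^ 'N \<Rightarrow> real"
  assumes [measurable]: "v \<in> borel_measurable borel" "\<Omega> \<in> sets borel"
    and q: "0 \<le> q"
    and v: "\<And>x. x \<notin> \<Omega> \<Longrightarrow> v x = 0"
    and \<eta>: "\<And>x. \<bar>\<eta> x\<bar> \<le> 1" "\<And>x. x \<notin> \<Omega> \<Longrightarrow> \<eta> x = 0"
    and L: "\<And>x y. \<bar>\<eta> x - \<eta> y\<bar> \<le> L * norm (x - y)"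
  shows "translation_energy q UNIV (\<lambda>x. \<eta> x *\<^sub>R v x) h
    \<le> ennreal (2 powr q) * (translation_energy q \<Omega> v h +
        ennreal (2 * (L * norm h) powr q) * (\<integral>\<^sup>+x. ennreal (norm (v x) powr q) \<partial>lborel))"
proof -
  define M where "M = (\<integral>\<^sup>+x. ennreal (norm (v x) powr q) \<partial>lborel)"
  have Lh: "0 \<le> L * norm h"
    using L[of h 0] by (simp add: order_trans[OF abs_ge_zero])
  have pointwise: "norm (\<eta> y *\<^sub>R v y - \<eta> x *\<^sub>R v x) powr q \<le> 2 powr q *
    (norm (v y - v x) powr q * indicator {x \<in> \<Omega>. x + h \<in> \<Omega>} x +
     (L * norm h) powr q * (norm (v y) powr q + norm (v x) powr q))" if y: "y = x + h" for x y
  proof -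
    \<comment> \<open>The maximum \<open>m\<close> covers whichever of \<open>v y\<close> and \<open>v x\<close> is multiplied by \<open>\<eta> y - \<eta> x\<close>.\<close>
    define D where "D = (if x \<in> \<Omega> \<and> y \<in> \<Omega> then norm (v y - v x) else 0)"
    define m where "m = max (norm (v y)) (norm (v x))"
    have Lxy: "\<bar>\<eta> y - \<eta> x\<bar> \<le> L * norm h"
      using L[of y x] y by simp
    have "norm (\<eta> y *\<^sub>R v y - \<eta> x *\<^sub>R v x) \<le> D + L * norm h * m"
    proof (cases "x \<in> \<Omega> \<and> y \<in> \<Omega>")
      case True
      have "\<eta> y *\<^sub>R v y - \<eta> x *\<^sub>R v x = \<eta> y *\<^sub>R (v y - v x) + (\<eta> y - \<eta> x) *\<^sub>R v x"
        by (simp add: algebra_simps)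
      also have "norm \<dots> \<le> \<bar>\<eta> y\<bar> * norm (v y - v x) + \<bar>\<eta> y - \<eta> x\<bar> * norm (v x)"
        by (metis norm_scaleR norm_triangle_ineq)
      also have "\<dots> \<le> 1 * norm (v y - v x) + L * norm h * m"
        using \<eta>(1) Lxy Lh by (intro add_mono mult_mono) (auto simp: m_def)
      finally show ?thesis
        using True by (simp add: D_def)
    next
      case False
      then have "norm (\<eta> y *\<^sub>R v y - \<eta> x *\<^sub>R v x) \<le> \<bar>\<eta> y - \<eta> x\<bar> * m"
        using v \<eta>(2) by (cases "x \<in> \<Omega>") (auto simp: m_def)
      also have "\<dots> \<le> L * norm h * m"
        using Lxy by (intro mult_right_mono) (auto simp: m_def max_def)
      also have "\<dots> = D + L * norm h * m"
        using False by (auto simp: D_def)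
      finally show ?thesis .
    qed
    then have "norm (\<eta> y *\<^sub>R v y - \<eta> x *\<^sub>R v x) powr q \<le> (D + L * norm h * m) powr q"
      using q by (intro powr_mono2) auto
    also have "\<dots> \<le> 2 powr q * (D powr q + (L * norm h * m) powr q)"
      using q Lh by (intro powr_add_le mult_nonneg_nonneg[OF Lh]) (auto simp: D_def m_def max_def)
    also have "(L * norm h * m) powr q = (L * norm h) powr q * m powr q"
      by (rule powr_mult)
    also have "m powr q \<le> norm (v y) powr q + norm (v x) powr q"
      by (simp add: m_def max_def)
    also have "D powr q = norm (v y - v x) powr q * indicator {x \<in> \<Omega>. x + h \<in> \<Omega>} x"
      using y by (auto simp: D_def indicator_def)
    finally show ?thesis
      by (simp add: mult_left_mono)
  qed
  have "translation_energy q UNIV (\<lambda>x. \<eta> x *\<^sub>R v x) h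
      \<le> (\<integral>\<^sup>+x. ennreal (2 powr q) *
        (ennreal (norm (v (x + h) - v x) powr q) * (indicator \<Omega> x * indicator \<Omega> (x + h)) +
         ennreal ((L * norm h) powr q) *
           (ennreal (norm (v (h + x)) powr q) + ennreal (norm (v x) powr q))) \<partial>lborel)"
    unfolding translation_energy_def
  proof (rule nn_integral_mono)
    fix x
    show "ennreal (norm (\<eta> (x + h) *\<^sub>R v (x + h) - \<eta> x *\<^sub>R v x) powr q) * indicator {x \<in> UNIV. x + h \<in> UNIV} x
      \<le> ennreal (2 powr q) *
        (ennreal (norm (v (x + h) - v x) powr q) * (indicator \<Omega> x * indicator \<Omega> (x + h)) +
         ennreal ((L * norm h) powr q) *
           (ennreal (norm (v (h + x)) powr q) + ennreal (norm (v x) powr q)))"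
      using ennreal_leI[OF pointwise[OF refl, of x]]
      by (auto simp: ennreal_mult' add.commute indicator_def split: if_splits)
  qed
  also have "\<dots> = ennreal (2 powr q) *
      ((\<integral>\<^sup>+x. ennreal (norm (v (x + h) - v x) powr q) * (indicator \<Omega> x * indicator \<Omega> (x + h)) \<partial>lborel) +
       ennreal ((L * norm h) powr q) * ((\<integral>\<^sup>+x. ennreal (norm (v (h + x)) powr q) \<partial>lborel) + M))"
    by (simp add: nn_integral_cmult nn_integral_add M_def)
  also have "(\<integral>\<^sup>+x. ennreal (norm (v (h + x)) powr q) \<partial>lborel) = M"
    unfolding M_def by (rule nn_integral_lborel_translate) measurable
  also have "(\<integral>\<^sup>+x. ennreal (norm (v (x + h) - v x) powr q) * (indicator \<Omega> x * indicator \<Omega> (x + h)) \<partial>lborel)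
      = translation_energy q \<Omega> v h"
    by (auto simp: translation_energy_def indicator_def intro!: nn_integral_cong)
  finally show ?thesis
    by (simp add: M_def ennreal_mult' mult_ac flip: mult_2)
qed


text \<open>
  The Lipschitz error in the energy is of order \<open>|h|\<^sup>q\<close>; as \<open>A_bar\<close> only sees \<open>|h| < 1\<close>, it is at most of
  order \<open>|h|\<close>, which is what \<open>A_bar_le\<close> tolerates.
\<close>

lemma cutoff_in_BVq:
  fixes v :: "real ^ 'N \<Rightarrow> real ^ 'd" and \<eta> :: "real ^ 'N \<Rightarrow> real"
  assumes [measurable]: "v \<in> borel_measurable borel" "\<Omega> \<in> sets borel" "\<eta> \<in> borel_measurable borel"
    and q: "1 \<le> q" and L0: "0 \<le> L"
    and v: "\<And>x. x \<notin> \<Omega> \<Longrightarrow> v x = 0"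
    and \<eta>: "\<And>x. \<bar>\<eta> x\<bar> \<le> 1" "\<And>x. x \<notin> \<Omega> \<Longrightarrow> \<eta> x = 0"
    and L: "\<And>x y. \<bar>\<eta> x - \<eta> y\<bar> \<le> L * norm (x - y)"
    and Lq: "(\<integral>\<^sup>+x. ennreal (norm (v x) powr q) \<partial>lborel) < \<infinity>"
    and A: "A_bar q \<Omega> v < \<infinity>"
  shows "(\<lambda>x. \<eta> x *\<^sub>R v x) \<in> BVq q UNIV"
proof -
  define M where "M = (\<integral>\<^sup>+x. ennreal (norm (v x) powr q) \<partial>lborel)"
  define C where "C = ennreal (2 powr q) * ennreal (2 * L powr q) * M"
  have "A_bar q UNIV (\<lambda>x. \<eta> x *\<^sub>R v x)
      \<le> ennreal (2 powr q) * A_bar q \<Omega> v + C * ennreal (unit_ball_vol CARD('N))"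
  proof (rule A_bar_le)
    fix h :: "real ^ 'N" assume h: "norm h < 1"
    have "norm h powr q \<le> norm h powr 1"
      using h q by (intro powr_mono') auto
    then have "2 * (L * norm h) powr q \<le> 2 * L powr q * norm h"
      using L0 by (simp add: powr_mult mult_left_mono)
    then have le: "ennreal (2 * (L * norm h) powr q) \<le> ennreal (2 * L powr q) * ennreal (norm h)"
      by (simp add: ennreal_mult'[symmetric] ennreal_leI)
    have "translation_energy q UNIV (\<lambda>x. \<eta> x *\<^sub>R v x) h
      \<le> ennreal (2 powr q) * (translation_energy q \<Omega> v h + ennreal (2 * (L * norm h) powr q) * M)"
      unfolding M_def using q v \<eta> L by (intro translation_energy_cutoff_le) auto
    also have "\<dots> \<le> ennreal (2 powr q) * (translation_energy q \<Omega> v h +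
        (ennreal (2 * L powr q) * ennreal (norm h)) * M)"
      by (intro mult_left_mono add_left_mono mult_right_mono le) auto
    also have "\<dots> = ennreal (2 powr q) * translation_energy q \<Omega> v h + C * ennreal (norm h)"
      unfolding C_def by (simp only: distrib_left mult_ac)
    finally show "translation_energy q UNIV (\<lambda>x. \<eta> x *\<^sub>R v x) h
      \<le> ennreal (2 powr q) * translation_energy q \<Omega> v h + C * ennreal (norm h)" .
  qed measurable
  also have "\<dots> < \<infinity>"
    using A Lq by (auto simp: C_def M_def ennreal_mult_less_top)
  finally have "A_bar q UNIV (\<lambda>x. \<eta> x *\<^sub>R v x) < \<infinity>" .
  moreover have "(\<lambda>x. \<eta> x *\<^sub>R v x) \<in> Lq q UNIV"
  proof (rule borel_measurable_in_Lq)
    have "(\<integral>\<^sup>+x. ennreal (norm (\<eta> x *\<^sub>R v x) powr q) \<partial>lborel) \<le> M"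
      unfolding M_def
    proof (intro nn_integral_mono ennreal_leI powr_mono2)
      show "norm (\<eta> x *\<^sub>R v x) \<le> norm (v x)" for x
        using \<eta>(1)[of x] by (simp add: mult_left_le_one_le)
    qed (use q in auto)
    also have "M < \<infinity>"
      using Lq by (simp add: M_def)
    finally show "(\<integral>\<^sup>+x. ennreal (norm (\<eta> x *\<^sub>R v x) powr q) \<partial>lborel) < \<infinity>" .
  qed measurable
  ultimately show ?thesis
    by (simp add: BVq_def)
qed

text \<open>
  With \<open>d\<close> the distance to \<open>K\<close> and \<open>\<delta>\<close> so small that the closed \<open>\<delta>\<close>-neighbourhood of \<open>K\<close> stays
  in \<open>\<Omega>\<close>, take \<open>\<eta> = max 0 (1 - d / \<delta>)\<close> and \<open>U = {d < \<delta>}\<close>.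
\<close>

lemma Lipschitz_cutoff:
  fixes K :: "'a :: {heine_borel, real_normed_vector} set"
  assumes K: "compact K" "K \<noteq> {}" "K \<subseteq> \<Omega>" and "open \<Omega>"
  obtains U :: "'a set" and \<eta> :: "'a \<Rightarrow> real" and L :: real
  where "open U" "compact (closure U)" "closure U \<subseteq> \<Omega>" "K \<subseteq> U"
    "\<And>x. \<bar>\<eta> x\<bar> \<le> 1" "\<And>x. x \<in> K \<Longrightarrow> \<eta> x = 1" "\<And>x. x \<notin> U \<Longrightarrow> \<eta> x = 0"
    "0 \<le> L" "\<And>x y. \<bar>\<eta> x - \<eta> y\<bar> \<le> L * norm (x - y)" "continuous_on UNIV \<eta>"
proof -
  obtain \<delta> where \<delta>: "0 < \<delta>" "{x. infdist x K \<le> \<delta>} \<subseteq> \<Omega>"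
    using compact_in_open_separated[OF K(2,1) \<open>open \<Omega>\<close> K(3)] by blast
  define U where "U = {x. infdist x K < \<delta>}"
  define \<eta> where "\<eta> x = max 0 (1 - infdist x K / \<delta>)" for x
  have compact: "compact {x. infdist x K \<le> \<delta>}"
    using K \<delta> by (intro compact_infdist_le) auto
  have sub: "closure U \<subseteq> {x. infdist x K \<le> \<delta>}"
    using compact by (intro closure_minimal compact_imp_closed) (auto simp: U_def)
  show thesis
  proof
    show "open U"
      unfolding U_def by (intro open_Collect_less continuous_intros)
    show "compact (closure U)"
      using compact sub by (metis closed_closure compact_Int_closed inf.absorb_iff2)
    show "closure U \<subseteq> \<Omega>"
      using sub \<delta> by blast
    show "K \<subseteq> U"
      using \<delta> by (auto simp: U_def)
    show "\<bar>\<eta> x\<bar> \<le> 1" for x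
      using \<delta> by (simp add: \<eta>_def infdist_nonneg)
    show "\<eta> x = 1" if "x \<in> K" for x
      using that by (simp add: \<eta>_def)
    show "\<eta> x = 0" if "x \<notin> U" for x
      using that \<delta> by (simp add: \<eta>_def U_def)
    show "0 \<le> 1 / \<delta>"
      using \<delta> by simp
    show "\<bar>\<eta> x - \<eta> y\<bar> \<le> 1 / \<delta> * norm (x - y)" for x y
    proof -
      have "\<bar>\<eta> x - \<eta> y\<bar> \<le> \<bar>infdist x K / \<delta> - infdist y K / \<delta>\<bar>"
        by (auto simp: \<eta>_def)
      also have "\<dots> = \<bar>infdist x K - infdist y K\<bar> / \<delta>"
        using \<delta> by (simp flip: diff_divide_distrib)
      also have "\<dots> \<le> norm (x - y) / \<delta>"
        using \<delta> infdist_triangle_abs[of x K y] by (intro divide_right_mono) (auto simp: dist_norm)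
      finally show ?thesis
        by simp
    qed
    show "continuous_on UNIV \<eta>"
      unfolding \<eta>_def using \<delta> by (intro continuous_intros) auto
  qed
qed

lemma Besov_loc_subset_BVq_loc:
  fixes \<Omega> :: "(real ^ 'N) set"
  assumes q: "0 < q"
  shows "(Besov_loc (1 / q) q \<Omega> :: (real ^ 'N \<Rightarrow> real ^ 'd) set) \<subseteq> BVq_loc q \<Omega>"
proof
  fix u :: "real ^ 'N \<Rightarrow> real ^ 'd" assume u: "u \<in> Besov_loc (1 / q) q \<Omega>"
  then have loc: "u \<in> Lq_loc q \<Omega>"
    by (simp add: Besov_loc_def)
  have "u \<in> BVq q U" if U: "open U" "compact (closure U)" "closure U \<subseteq> \<Omega>" for U
  proof -
    have "u \<in> Lq q (closure U)"
      using loc U by (simp add: Lq_loc_def)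
    then have uU: "u \<in> Lq q U"
      by (rule Lq_subset) (use U closure_subset in auto)
    obtain w where w: "w \<in> Besov (1 / q) q"
      and "AE x in lebesgue. x \<in> closure U \<longrightarrow> w x = u x"
      using u U unfolding Besov_loc_def by blast
    then have "AE x in lborel. x \<in> closure U \<longrightarrow> w x = u x"
      by (simp add: AE_completion_iff)
    then have "AE x in lborel. x \<in> U \<longrightarrow> w x = u x"
      by eventually_elim (use closure_subset in auto)
    then have "A_bar q U u = A_bar q U w"
      by (rule A_bar_AE_cong[symmetric])
    also have "\<dots> \<le> A_bar q UNIV w"
      by (intro A_bar_mono) simp
    also have "\<dots> < \<infinity>"
      using w q by (simp add: BVq_UNIV_eq_Besov[symmetric] BVq_def)
    finally show ?thesis
      using uU by (simp add: BVq_def)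
  qed
  with loc show "u \<in> BVq_loc q \<Omega>"
    by (simp add: BVq_loc_def)
qed

text \<open>
  The function required on a compact set \<open>K\<close> is \<open>\<eta> u\<close> for a cutoff \<open>\<eta>\<close> around \<open>K\<close>. The empty
  compact set is treated apart because the distance to it is 0 everywhere by convention, which makes
  the cutoff useless.
\<close>

lemma BVq_loc_subset_Besov_loc:
  fixes \<Omega> :: "(real ^ 'N) set"
  assumes q: "1 \<le> q" and "open \<Omega>"
  shows "(BVq_loc q \<Omega> :: (real ^ 'N \<Rightarrow> real ^ 'd) set) \<subseteq> Besov_loc (1 / q) q \<Omega>"
proof
  fix u :: "real ^ 'N \<Rightarrow> real ^ 'd" assume u: "u \<in> BVq_loc q \<Omega>"
  have "\<exists>w \<in> Besov (1 / q) q. AE x in lebesgue. x \<in> K \<longrightarrow> w x = u x"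
    if K: "compact K" "K \<subseteq> \<Omega>" for K
  proof (cases "K = {}")
    case True
    have "(\<lambda>x. 0 :: real ^ 'd) \<in> BVq q (UNIV :: (real ^ 'N) set)"
      by (auto simp: BVq_def A_bar_def intro!: borel_measurable_in_Lq)
    then show ?thesis
      using True q by (auto simp: BVq_UNIV_eq_Besov)
  next
    case False
    from Lipschitz_cutoff[OF K(1) False K(2) \<open>open \<Omega>\<close>] obtain U \<eta> L
      where U: "open U" "compact (closure U)" "closure U \<subseteq> \<Omega>" "K \<subseteq> U"
      and \<eta>: "\<And>x. \<bar>\<eta> x\<bar> \<le> 1" "\<And>x. x \<in> K \<Longrightarrow> \<eta> x = 1" "\<And>x. x \<notin> U \<Longrightarrow> \<eta> x = (0 :: real)"
      and L: "0 \<le> L" "\<And>x y. \<bar>\<eta> x - \<eta> y\<bar> \<le> L * norm (x - y)"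
      and cont: "continuous_on UNIV \<eta>"
      by blast
    have "u \<in> BVq q U"
      using u U by (simp add: BVq_loc_def)
    then have uL: "u \<in> Lq q U" and uA: "A_bar q U u < \<infinity>"
      by (auto simp: BVq_def)
    obtain v where v: "v \<in> borel_measurable borel" "AE x in lborel. x \<in> U \<longrightarrow> v x = u x"
      "\<And>x. x \<notin> U \<Longrightarrow> v x = 0" "(\<integral>\<^sup>+x. ennreal (norm (v x) powr q) \<partial>lborel) < \<infinity>"
      by (rule Lq_representative[OF uL]) (use U in auto)
    have "A_bar q U v < \<infinity>"
      using uA A_bar_AE_cong[OF v(2)] by simp
    then have "(\<lambda>x. \<eta> x *\<^sub>R v x) \<in> BVq q UNIV"
      using q U v \<eta> L borel_measurable_continuous_onI[OF cont]
      by (intro cutoff_in_BVq[where \<Omega> = U and L = L]) auto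
    moreover have "AE x in lborel. x \<in> K \<longrightarrow> \<eta> x *\<^sub>R v x = u x"
      using v(2) by eventually_elim (use U \<eta> in auto)
    ultimately show ?thesis
      using q by (auto simp: BVq_UNIV_eq_Besov AE_completion_iff)
  qed
  with u show "u \<in> Besov_loc (1 / q) q \<Omega>"
    by (simp add: Besov_loc_def BVq_loc_def)
qed

theorem proposition1p1:
  fixes q :: real
  assumes "q > 1"
  shows "(BVq q UNIV :: (real ^ 'N \<Rightarrow> real ^ 'd) set) = Besov (1 / q) q \<and>
         (\<forall>\<Omega> :: (real ^ 'N) set. open \<Omega> \<longrightarrow>
            (BVq_loc q \<Omega> :: (real ^ 'N \<Rightarrow> real ^ 'd) set) = Besov_loc (1 / q) q \<Omega>)"
proof (intro conjI allI impI)
  show "(BVq q UNIV :: (real ^ 'N \<Rightarrow> real ^ 'd) set) = Besov (1 / q) q"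
    using assms by (intro BVq_UNIV_eq_Besov) simp
  show "(BVq_loc q \<Omega> :: (real ^ 'N \<Rightarrow> real ^ 'd) set) = Besov_loc (1 / q) q \<Omega>"
    if "open \<Omega>" for \<Omega> :: "(real ^ 'N) set"
    using assms that
    by (intro equalityI BVq_loc_subset_Besov_loc Besov_loc_subset_BVq_loc) auto
qed

end
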